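(* Let $I$ and $\Gamma$ be arbitrary sets with $I$ uncountable, let $w:\Gamma\to(0,\infty)$ be any weight function, and let $1<p<\infty$, $p\neq 2$. Then $\ell^{p,\infty}(\Gamma,w)$ does not contain a subspace isomorphic to $\ell^2(I)$. Consequently, for $p\neq2$, $L^{p,\infty}(\{-1,1\}^I)$ is not isomorphic to a subspace of $L^{p,\infty}(\Omega,\Sigma,\mu)$ for any purely atomic measure space $(\Omega,\Sigma,\mu)$.
   Context: $\ell^{p,\infty}(\Gamma,w)$ denotes $L^{p,\infty}(\Gamma,\mathcal P(\Gamma),\mu)$ where $\mu(\sigma)=\sum_{\gamma\in\sigma}w(\gamma)$. For a measure space $(\Omega,\Sigma,\mu)$, $L^{p,\infty}(\Omega,\Sigma,\mu)$ is the space of (equivalence classes of) measurable $f$ with $\|f\|=\sup_{c>0}c\,(\mu\{|f|>c\})^{1/p}<\infty$, a Banach space under an equivalent norm; isomorphism means linear homeomorphism. $\{-1,1\}^I$ is the product of $I$ copies of the two-point probability space $\{-1,1\}$ with masses $\frac12$. An atom is a measurable $\sigma$ with $\mu(\sigma)>0$ such that each measurable $\sigma'\subseteq\sigma$ has $\mu(\sigma')=0$ or $\mu(\sigma\setminus\sigma')=0$; purely atomic means $\Sigma$ is the smallest $\sigma$-algebra containing all atoms and null sets. Measure spaces are assumed to contain a set of finite non-zero measure. *)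

theory Defs
  imports "HOL-Probability.Probability"
begin

definition weak_norm :: "real \<Rightarrow> 'a measure \<Rightarrow> ('a \<Rightarrow> real) \<Rightarrow> ennreal" where
  "weak_norm p M f =
     (SUP c\<in>{0<..}. (if emeasure M {x\<in>space M. c < \<bar>f x\<bar>} = \<infinity> then \<infinity>
        else ennreal (c * (measure M {x\<in>space M. c < \<bar>f x\<bar>}) powr (1/p))))"

text \<open>L^{p,infinity}(M): measurable functions with finite weak quasinorm (elements are
  representatives; a.e. equal functions represent the same element).\<close>
definition weak_Lp :: "real \<Rightarrow> 'a measure \<Rightarrow> ('a \<Rightarrow> real) set" where
  "weak_Lp p M = {f. f \<in> borel_measurable M \<and> weak_norm p M f < \<infinity>}"

definition weighted_measure :: "'g set \<Rightarrow> ('g \<Rightarrow> real) \<Rightarrow> 'g measure" where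
  "weighted_measure \<Gamma> w = point_measure \<Gamma> (\<lambda>g. ennreal (w g))"

definition ell2 :: "'i set \<Rightarrow> ('i \<Rightarrow> real) set" where
  "ell2 I = {x. (\<forall>i. i \<notin> I \<longrightarrow> x i = 0) \<and> (\<lambda>i. (x i)^2) summable_on I}"

definition ell2_norm :: "'i set \<Rightarrow> ('i \<Rightarrow> real) \<Rightarrow> real" where
  "ell2_norm I x = sqrt (infsum (\<lambda>i. (x i)^2) I)"

definition cantor_cube :: "'i set \<Rightarrow> ('i \<Rightarrow> real) measure" where
  "cantor_cube I = PiM I (\<lambda>_. uniform_count_measure {-1, 1::real})"

text \<open>Isomorphic embedding of the (semi)normed space (X,nX) into the quasinormed space (Y,nY):
  a map T, linear modulo elements of Y of quasinorm zero (i.e. a.e.), with two-sided bounds.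
  Since the weak quasinorm is equivalent to a norm, this is exactly a linear homeomorphism
  onto its image.\<close>
definition iso_embeds ::
  "('a \<Rightarrow> real) set \<Rightarrow> (('a \<Rightarrow> real) \<Rightarrow> real) \<Rightarrow> ('b \<Rightarrow> real) set \<Rightarrow> (('b \<Rightarrow> real) \<Rightarrow> ennreal) \<Rightarrow> bool"
  where
  "iso_embeds X nX Y nY \<longleftrightarrow>
    (\<exists>T c C. 0 < c \<and> 0 < C \<and>
      (\<forall>f\<in>X. T f \<in> Y \<and> ennreal (c * nX f) \<le> nY (T f) \<and> nY (T f) \<le> ennreal (C * nX f)) \<and>
      (\<forall>f\<in>X. \<forall>g\<in>X. \<forall>a b::real.
         nY (\<lambda>y. T (\<lambda>x. a * f x + b * g x) y - (a * T f y + b * T g y)) = 0))"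

definition atom :: "'a measure \<Rightarrow> 'a set \<Rightarrow> bool" where
  "atom M A \<longleftrightarrow> A \<in> sets M \<and> 0 < emeasure M A \<and>
     (\<forall>B\<in>sets M. B \<subseteq> A \<longrightarrow> emeasure M B = 0 \<or> emeasure M (A - B) = 0)"

definition purely_atomic :: "'a measure \<Rightarrow> bool" where
  "purely_atomic M \<longleftrightarrow>
     sets M = sigma_sets (space M) ({A. atom M A} \<union> {N\<in>sets M. emeasure M N = 0})"

end

theory Submission
  imports Defs
begin

text \<open>Suppose that \<open>f i\<close>, \<open>i \<in> I\<close>, are functions in \<open>L\<^sup>p\<^sup>,\<^sup>\<infinity>\<close> whose signed sums over \<open>n\<close>-element index sets
  have norm comparable to \<open>\<surd>n\<close>. Adding with the right signs on an atom \<open>A\<close> shows that only countably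
  many \<open>f i\<close> are nonzero on \<open>A\<close>; since a set of finite measure is essentially a countable union of atoms,
  each \<open>f i\<close> meets only countably many others. By uncountability there are arbitrarily large
  almost disjoint finite subfamilies which moreover all exceed a common level on sets of measure bounded
  from below. The norm of a sum of \<open>n\<close> such functions is comparable to \<open>n powr (1/p)\<close>, which forces
  \<open>p = 2\<close>. Only signed sums are needed, so on the cube one uses the coordinate functions, for which
  the weak norm of a signed sum is estimated from exponential and second moments.\<close>

section \<open>The weak norm and the distribution function\<close>

text \<open>Taking \<open>p\<close>-th powers level by level removes the supremum, the root and the
  infinite case of the definition, so that norm estimates become estimates of tail measures.\<close>

lemma weak_norm_le_iff:
  assumes "0 < p" "0 \<le> K"
  shows "weak_norm p M f \<le> ennreal K \<longleftrightarrow>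
    (\<forall>t>0. emeasure M {x\<in>space M. t < \<bar>f x\<bar>} \<le> ennreal ((K / t) powr p))"
proof -
  have "(if emeasure M S = \<infinity> then \<infinity> else ennreal (t * measure M S powr (1/p))) \<le> ennreal K
      \<longleftrightarrow> emeasure M S \<le> ennreal ((K / t) powr p)" if t: "0 < t" for t and S :: "'a set"
  proof (cases "emeasure M S = \<infinity>")
    case True
    then show ?thesis by (simp add: top_unique)
  next
    case False
    then have eq: "emeasure M S = ennreal (measure M S)"
      by (simp add: emeasure_eq_ennreal_measure)
    have "t * measure M S powr (1/p) \<le> K \<longleftrightarrow> measure M S powr (1/p) \<le> K / t"
      using t by (simp add: field_simps)
    also have "\<dots> \<longleftrightarrow> (measure M S powr (1/p)) powr p \<le> (K / t) powr p"
      using assms t powr_mono2[of p "measure M S powr (1/p)" "K / t"]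
        powr_less_mono2[of p "K / t" "measure M S powr (1/p)"] by fastforce
    also have "(measure M S powr (1/p)) powr p = measure M S"
      using assms by (simp add: powr_powr)
    finally show ?thesis using False eq assms by (simp add: ennreal_le_iff)
  qed
  then show ?thesis
    unfolding weak_norm_def SUP_le_iff by (auto simp: Ball_def)
qed

lemma weak_norm_cong_AE:
  assumes [measurable]: "f \<in> borel_measurable M" "g \<in> borel_measurable M"
    and "AE x in M. f x = g x"
  shows "weak_norm p M f = weak_norm p M g"
proof -
  have "emeasure M {x\<in>space M. t < \<bar>f x\<bar>} = emeasure M {x\<in>space M. t < \<bar>g x\<bar>}" for t
    using assms(3) by (intro emeasure_eq_AE) (auto elim!: eventually_mono)
  then show ?thesis
    unfolding weak_norm_def measure_def by simp
qed

text \<open>Every level set at \<open>1 / Suc n\<close> is null. This turns linearity modulo norm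
  zero, as in \<open>iso_embeds\<close>, into linearity almost everywhere.\<close>

lemma weak_norm_eq_0_imp_AE:
  assumes [measurable]: "f \<in> borel_measurable M" and "0 < p" "weak_norm p M f = 0"
  shows "AE x in M. f x = 0"
proof -
  have "\<forall>t>0. emeasure M {x\<in>space M. t < \<bar>f x\<bar>} \<le> 0"
    using assms weak_norm_le_iff[of p 0 M f] by simp
  then have "AE x in M. \<not> 1 / real (Suc n) < \<bar>f x\<bar>" for n
    by (subst AE_iff_measurable[OF _ refl]) (simp_all del: of_nat_Suc)
  then have "AE x in M. \<forall>n. \<not> 1 / real (Suc n) < \<bar>f x\<bar>"
    by (simp add: AE_all_countable)
  then show ?thesis
  proof eventually_elim
    case (elim x)
    then show ?case using reals_Archimedean[of "\<bar>f x\<bar>"] by (auto simp: inverse_eq_divide)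
  qed
qed

section \<open>Atoms in sets of finite measure\<close>

text \<open>The form of atomicity shared by weighted counting measures and purely atomic measures.
  Sets of finite measure suffice, since the level sets of a function of finite weak norm at positive
  levels are of this kind.\<close>

definition atomic_on_finite :: "'a measure \<Rightarrow> bool" where
  "atomic_on_finite M \<longleftrightarrow>
    (\<forall>S\<in>sets M. 0 < emeasure M S \<longrightarrow> emeasure M S < \<infinity> \<longrightarrow> (\<exists>A\<subseteq>S. atom M A))"

text \<open>Positive weights make every singleton an atom.\<close>

lemma atomic_on_finite_weighted_measure:
  assumes "\<forall>g\<in>\<Gamma>. 0 < w g"
  shows "atomic_on_finite (weighted_measure \<Gamma> w)"
  unfolding atomic_on_finite_def
proof (intro ballI impI)
  fix S assume S: "S \<in> sets (weighted_measure \<Gamma> w)" "0 < emeasure (weighted_measure \<Gamma> w) S"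
  have sets: "sets (weighted_measure \<Gamma> w) = Pow \<Gamma>"
    by (simp add: weighted_measure_def sets_point_measure)
  from S obtain g where g: "g \<in> S" by fastforce
  with S sets have g\<Gamma>: "g \<in> \<Gamma>" by auto
  have "emeasure (weighted_measure \<Gamma> w) {g} = ennreal (w g)"
    using g\<Gamma> by (simp add: weighted_measure_def emeasure_point_measure_finite2)
  then have "atom (weighted_measure \<Gamma> w) {g}"
    using g\<Gamma> assms unfolding atom_def sets subset_singleton_iff by simp
  with g show "\<exists>A\<subseteq>S. atom (weighted_measure \<Gamma> w) A" by (intro exI[of _ "{g}"]) simp
qed

lemma atom_positive_subset:
  assumes "atom M A" "B \<in> sets M" "B \<subseteq> A" "0 < emeasure M B"
  shows "atom M B"
  unfolding atom_def
proof (intro conjI ballI impI)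
  fix C assume C: "C \<in> sets M" "C \<subseteq> B"
  with assms have "emeasure M C = 0 \<or> emeasure M (A - C) = 0"
    unfolding atom_def by blast
  moreover have "emeasure M (B - C) \<le> emeasure M (A - C)"
    using assms C by (intro emeasure_mono) (auto simp: atom_def)
  ultimately show "emeasure M C = 0 \<or> emeasure M (B - C) = 0" by auto
qed (use assms in auto)

text \<open>A set containing no atom is split trivially by every atom and every null set, hence by the
  \<open>\<sigma>\<close>-algebra they generate; if it had positive measure it would be an atom itself.\<close>
lemma atomic_on_finite_purely_atomic:
  assumes "purely_atomic M"
  shows "atomic_on_finite M"
  unfolding atomic_on_finite_def
proof (intro ballI impI, rule ccontr)
  fix S assume S: "S \<in> sets M" "0 < emeasure M S"
    and no_atom: "\<not> (\<exists>A\<subseteq>S. atom M A)"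
  define G where "G = {A. atom M A} \<union> {N\<in>sets M. emeasure M N = 0}"
  have sets: "sets M = sigma_sets (space M) G"
    using assms by (simp add: purely_atomic_def G_def)
  have triv: "E \<inter> S \<in> null_sets M \<or> S - E \<in> null_sets M" if "E \<in> sigma_sets (space M) G" for E
    using that
  proof induction
    case (Basic E)
    have E: "E \<in> sets M" using Basic by (auto simp: G_def atom_def)
    \<comment> \<open>A generator \<open>E\<close> that meets \<open>S\<close> in positive measure
      is not null, hence an atom; then \<open>E \<inter> S\<close> is an atom inside
      \<open>S\<close>.\<close>
    have "emeasure M (E \<inter> S) = 0"
    proof (rule ccontr)
      assume pos: "emeasure M (E \<inter> S) \<noteq> 0"
      have "emeasure M (E \<inter> S) \<le> emeasure M E" using E by (intro emeasure_mono) auto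
      with pos Basic have "atom M E" by (auto simp: G_def)
      moreover have "0 < emeasure M (E \<inter> S)" using pos by (simp add: zero_less_iff_neq_zero)
      ultimately have "atom M (E \<inter> S)"
        using atom_positive_subset[of M E "E \<inter> S"] E S(1) by blast
      with no_atom Int_lower2[of E S] show False by metis
    qed
    then show ?case using E S by (intro disjI1 null_setsI) simp_all
  next
    case Empty
    then show ?case by simp
  next
    case (Compl E)
    have "E \<in> sets M" using Compl sets by simp
    moreover have "(space M - E) \<inter> S = S - E" "S - (space M - E) = E \<inter> S"
      using sets.sets_into_space[OF S(1)] by auto
    ultimately show ?case using Compl by auto
  next
    case (Union E)
    then have E: "E n \<in> sets M" for n using sets by simp
    show ?case
    proof (cases "\<forall>n. E n \<inter> S \<in> null_sets M")
      case True
      then have "(\<Union>n. E n \<inter> S) \<in> null_sets M" by (intro null_sets_UN) auto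
      moreover have "(\<Union>n. E n \<inter> S) = \<Union>(range E) \<inter> S" by auto
      ultimately show ?thesis by simp
    next
      case False
      then obtain n where "S - E n \<in> null_sets M" using Union.IH by blast
      then have "S - \<Union>(range E) \<in> null_sets M"
        by (rule null_sets_subset) (use E S in auto)
      then show ?thesis ..
    qed
  qed
  have "atom M S"
    unfolding atom_def
  proof (intro conjI ballI impI)
    fix B assume B: "B \<in> sets M" "B \<subseteq> S"
    then have "B \<inter> S = B" by auto
    with triv[of B] B sets show "emeasure M B = 0 \<or> emeasure M (S - B) = 0" by auto
  qed (use S in auto)
  with no_atom show False by blast
qed

text \<open>Exhaustion: among countable families of atoms in \<open>S\<close>, take one whose union
  has the largest measure. A remainder of positive measure would contain a further atom, and adding
  it would increase the maximum, which is finite.\<close>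

lemma countable_atoms_cover:
  assumes "atomic_on_finite M" and S: "S \<in> sets M" "emeasure M S < \<infinity>"
  obtains \<A> where "countable \<A>" "\<And>A. A \<in> \<A> \<Longrightarrow> atom M A \<and> A \<subseteq> S" "S - \<Union>\<A> \<in> null_sets M"
proof -
  define G where "G = {\<A>. countable \<A> \<and> (\<forall>A\<in>\<A>. atom M A \<and> A \<subseteq> S)}"
  have meas: "\<Union>\<A> \<in> sets M" "\<Union>\<A> \<subseteq> S" if "\<A> \<in> G" for \<A>
    using that by (auto simp: G_def atom_def intro!: sets.countable_Union)
  have "G \<noteq> {}" by (auto simp: G_def intro!: exI[of _ "{}"])
  \<comment> \<open>The supremum is reached along a sequence of countable families; the union of
    these families is again countable and attains it.\<close>
  from ennreal_SUP_countable_SUP[OF this, of "\<lambda>\<A>. emeasure M (\<Union>\<A>)"]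
  obtain \<phi> :: "nat \<Rightarrow> ennreal" where \<phi>: "range \<phi> \<subseteq> (\<lambda>\<A>. emeasure M (\<Union>\<A>)) ` G"
    and sup: "(SUP \<A>\<in>G. emeasure M (\<Union>\<A>)) = (SUP n. \<phi> n)" by auto
  then have "\<forall>n. \<exists>\<A>\<in>G. \<phi> n = emeasure M (\<Union>\<A>)" by blast
  then obtain \<B> where \<B>: "\<And>n. \<B> n \<in> G" "\<And>n. \<phi> n = emeasure M (\<Union>(\<B> n))" by metis
  define \<A> where "\<A> = (\<Union>n. \<B> n)"
  have \<A>: "\<A> \<in> G" using \<B>(1) by (auto simp: \<A>_def G_def)
  have max: "emeasure M (\<Union>\<C>) \<le> emeasure M (\<Union>\<A>)" if "\<C> \<in> G" for \<C>
  proof -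
    have "emeasure M (\<Union>\<C>) \<le> (SUP \<A>\<in>G. emeasure M (\<Union>\<A>))" by (rule SUP_upper[OF that])
    also have "\<dots> \<le> emeasure M (\<Union>\<A>)"
      unfolding sup \<B>(2) using meas[OF \<A>]
      by (intro SUP_least emeasure_mono) (auto simp: \<A>_def)
    finally show ?thesis .
  qed
  have "emeasure M (S - \<Union>\<A>) = 0"
  proof (rule ccontr)
    assume pos: "emeasure M (S - \<Union>\<A>) \<noteq> 0"
    have le: "emeasure M (S - \<Union>\<A>) \<le> emeasure M S" "emeasure M (\<Union>\<A>) \<le> emeasure M S"
      using S meas[OF \<A>] by (auto intro!: emeasure_mono)
    have "S - \<Union>\<A> \<in> sets M" using S meas[OF \<A>] by auto
    moreover have "0 < emeasure M (S - \<Union>\<A>)" using pos by (simp add: zero_less_iff_neq_zero)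
    moreover have "emeasure M (S - \<Union>\<A>) < \<infinity>" using le(1) S(2) by (rule le_less_trans)
    ultimately obtain A where A: "A \<subseteq> S - \<Union>\<A>" "atom M A"
      using assms(1) unfolding atomic_on_finite_def by blast
    have "insert A \<A> \<in> G" using A \<A> by (auto simp: G_def)
    from max[OF this] have "emeasure M (A \<union> \<Union>\<A>) \<le> emeasure M (\<Union>\<A>)" by simp
    moreover have "emeasure M (A \<union> \<Union>\<A>) = emeasure M A + emeasure M (\<Union>\<A>)"
      using A meas[OF \<A>] by (intro plus_emeasure[symmetric]) (auto simp: atom_def)
    moreover have "0 < emeasure M A" "emeasure M (\<Union>\<A>) < \<infinity>"
      using A S le by (auto simp: atom_def)
    ultimately show False
      using ennreal_add_left_cancel_less[of "emeasure M (\<Union>\<A>)" 0 "emeasure M A"]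
      by (auto simp: add.commute)
  qed
  then have "S - \<Union>\<A> \<in> null_sets M" using S meas[OF \<A>] by auto
  with \<A> show ?thesis by (intro that[of \<A>]) (auto simp: G_def)
qed

section \<open>Families whose signed sums grow like the square root\<close>

text \<open>Isolates what an embedding transports to the target space. Signs enter only through the
  upper bound, where they make summands on an atom add up without cancellation.\<close>

locale l2_sign_family =
  fixes M :: "'o measure" and p :: real and I :: "'i set" and f :: "'i \<Rightarrow> 'o \<Rightarrow> real"
    and c C :: real
  assumes atomic: "atomic_on_finite M"
    and p_pos: "0 < p"
    and uncountable_I: "uncountable I"
    and meas: "\<And>i. i \<in> I \<Longrightarrow> f i \<in> borel_measurable M"
    and c_pos: "0 < c" and C_pos: "0 < C"
    and upper: "\<And>F s. finite F \<Longrightarrow> F \<subseteq> I \<Longrightarrow> s \<in> F \<rightarrow> {-1, 1} \<Longrightarrow>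
      weak_norm p M (\<lambda>x. \<Sum>i\<in>F. s i * f i x) \<le> ennreal (C * sqrt (card F))"
    and lower: "\<And>F. finite F \<Longrightarrow> F \<subseteq> I \<Longrightarrow>
      ennreal (c * sqrt (card F)) \<le> weak_norm p M (\<lambda>x. \<Sum>i\<in>F. f i x)"
begin

lemma emeasure_level_le:
  assumes "finite F" "F \<subseteq> I" "s \<in> F \<rightarrow> {-1, 1}" "0 < t"
  shows "emeasure M {x\<in>space M. t < \<bar>\<Sum>i\<in>F. s i * f i x\<bar>}
    \<le> ennreal ((C * sqrt (card F) / t) powr p)"
proof -
  have "0 \<le> C * sqrt (card F)" using C_pos by simp
  from iffD1[OF weak_norm_le_iff[OF p_pos this] upper[OF assms(1-3)]] assms(4)
  show ?thesis by simp
qed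

lemma emeasure_level_single:
  assumes "i \<in> I" "0 < t"
  shows "emeasure M {x\<in>space M. t < \<bar>f i x\<bar>} \<le> ennreal ((C / t) powr p)"
  using emeasure_level_le[of "{i}" "\<lambda>_. 1" t] assms by simp

text \<open>Infinitely many functions exceeding \<open>\<epsilon>\<close> on \<open>A\<close> can be added up with the right signs: the sum of
  \<open>k\<close> of them exceeds \<open>k \<epsilon>\<close> there, while its norm only grows like \<open>\<surd>k\<close>.\<close>
lemma finite_large_on_set:
  assumes A: "A \<in> sets M" "0 < emeasure M A" and e: "0 < \<epsilon>"
  shows "finite {i\<in>I. \<exists>s\<in>{-1, 1}. AE x in M. x \<in> A \<longrightarrow> \<epsilon> < s * f i x}"
proof (rule ccontr)
  define B where "B = {i\<in>I. \<exists>s\<in>{-1, 1}. AE x in M. x \<in> A \<longrightarrow> \<epsilon> < s * f i x}"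
  assume "\<not> ?thesis"
  then have inf: "infinite B" by (simp only: B_def) simp
  have BI: "B \<subseteq> I" by (auto simp: B_def)
  have "\<forall>i\<in>B. \<exists>s. s \<in> {-1, 1} \<and> (AE x in M. x \<in> A \<longrightarrow> \<epsilon> < s * f i x)"
    unfolding B_def by blast
  then obtain s where s: "\<And>i. i \<in> B \<Longrightarrow> s i \<in> {-1, 1}"
    "\<And>i. i \<in> B \<Longrightarrow> AE x in M. x \<in> A \<longrightarrow> \<epsilon> < s i * f i x" by metis
  have bound: "emeasure M A \<le> ennreal ((C / \<epsilon> * (1 / sqrt k)) powr p)" if k: "0 < k" for k :: nat
  proof -
    obtain F where F: "finite F" "card F = k" "F \<subseteq> B"
      using infinite_arbitrarily_large[OF inf] by blast
    have [measurable]: "f i \<in> borel_measurable M" if "i \<in> F" for i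
      using meas F(3) BI that by blast
    have "AE x in M. \<forall>i\<in>F. x \<in> A \<longrightarrow> \<epsilon> < s i * f i x"
      by (rule AE_finite_allI[OF F(1)], rule s(2)) (use F(3) in blast)
    then have "AE x in M. x \<in> A \<longrightarrow>
        x \<in> {x\<in>space M. real k * \<epsilon> < \<bar>\<Sum>i\<in>F. s i * f i x\<bar>}"
      using AE_space
    proof eventually_elim
      case (elim x)
      show ?case
      proof
        assume "x \<in> A"
        with elim have "(\<Sum>i\<in>F. \<epsilon>) < (\<Sum>i\<in>F. s i * f i x)"
          using F k by (intro sum_strict_mono) auto
        then show "x \<in> {x\<in>space M. real k * \<epsilon> < \<bar>\<Sum>i\<in>F. s i * f i x\<bar>}"
          using elim F by simp
      qed
    qed
    then have "emeasure M A \<le> emeasure M {x\<in>space M. real k * \<epsilon> < \<bar>\<Sum>i\<in>F. s i * f i x\<bar>}"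
      by (rule emeasure_mono_AE) simp
    also have "\<dots> \<le> ennreal ((C * sqrt (card F) / (real k * \<epsilon>)) powr p)"
      using F BI s e k by (intro emeasure_level_le) auto
    also have "C * sqrt (card F) / (real k * \<epsilon>) = C / \<epsilon> * (1 / sqrt k)"
      using k e F by (simp add: field_simps flip: real_sqrt_mult)
    finally show ?thesis .
  qed
  \<comment> \<open>The bound on the measure of \<open>A\<close> tends to \<open>0\<close>;
    \<open>Suc k\<close> keeps the number of summands positive.\<close>
  have "(\<lambda>k. C / \<epsilon> * (1 / sqrt (real (Suc k)))) \<longlonglongrightarrow> C / \<epsilon> * 0"
    by (intro tendsto_mult tendsto_const tendsto_divide_0[OF tendsto_const] filterlim_at_top_imp_at_infinity
        filterlim_compose[OF sqrt_at_top] filterlim_compose[OF filterlim_real_sequentially filterlim_Suc])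
  then have "(\<lambda>k. ennreal ((C / \<epsilon> * (1 / sqrt (real (Suc k)))) powr p)) \<longlonglongrightarrow> ennreal (0 powr p)"
    using p_pos C_pos e by (intro tendsto_ennrealI tendsto_powr') auto
  then have "emeasure M A \<le> ennreal (0 powr p)"
    by (rule LIMSEQ_le_const) (use bound in blast)
  with A show False by simp
qed

text \<open>On an atom, the set where \<open>s * f i\<close> exceeds \<open>1 / Suc n\<close> is
  either null or almost everything. If \<open>f i\<close> does not vanish almost everywhere on
  \<open>A\<close>, the second case occurs for some \<open>n\<close> and some sign, so
  \<open>i\<close> lies in one of countably many finite sets.\<close>

lemma countable_nonzero_on_atom:
  assumes "atom M A"
  shows "countable {i\<in>I. \<not> (AE x in M. x \<in> A \<longrightarrow> f i x = 0)}"
proof -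
  let ?L = "\<lambda>n. {i\<in>I. \<exists>s\<in>{-1, 1}. AE x in M. x \<in> A \<longrightarrow> 1 / real (Suc n) < s * f i x}"
  have A: "A \<in> sets M" "0 < emeasure M A" using assms by (auto simp: atom_def)
  have "{i\<in>I. \<not> (AE x in M. x \<in> A \<longrightarrow> f i x = 0)} \<subseteq> (\<Union>n. ?L n)"
  proof
    fix i assume i: "i \<in> {i\<in>I. \<not> (AE x in M. x \<in> A \<longrightarrow> f i x = 0)}"
    then have [measurable]: "f i \<in> borel_measurable M" using meas by auto
    note [measurable] = A(1)
    show "i \<in> (\<Union>n. ?L n)"
    proof (rule ccontr)
      assume no: "i \<notin> (\<Union>n. ?L n)"
      have "AE x in M. x \<in> A \<longrightarrow> \<not> 1 / real (Suc n) < s * f i x" if s: "s \<in> {-1, 1}" for n s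
      proof -
        define B where "B = {x\<in>space M. x \<in> A \<and> 1 / real (Suc n) < s * f i x}"
        have B: "B \<in> sets M" "B \<subseteq> A" by (auto simp: B_def)
        have "emeasure M (A - B) \<noteq> 0"
        proof
          assume "emeasure M (A - B) = 0"
          then have "A - B \<in> null_sets M" using B A by auto
          then have "AE x in M. x \<notin> A - B" by (rule AE_not_in)
          then have "AE x in M. x \<in> A \<longrightarrow> 1 / real (Suc n) < s * f i x"
            by eventually_elim (auto simp: B_def)
          with no s i show False by blast
        qed
        with B assms have "emeasure M B = 0" unfolding atom_def by blast
        with B have "B \<in> null_sets M" by auto
        then have "AE x in M. x \<notin> B" by (rule AE_not_in)
        then show ?thesis using AE_space by eventually_elim (auto simp: B_def)
      qed
      then have "AE x in M. \<forall>n. x \<in> A \<longrightarrow> \<not> 1 / real (Suc n) < 1 * f i x"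
        "AE x in M. \<forall>n. x \<in> A \<longrightarrow> \<not> 1 / real (Suc n) < -1 * f i x"
        unfolding AE_all_countable by blast+
      then have "AE x in M. x \<in> A \<longrightarrow> f i x = 0"
      proof eventually_elim
        case (elim x)
        show ?case
        proof (rule ccontr)
          assume x: "\<not> (x \<in> A \<longrightarrow> f i x = 0)"
          then obtain n where "inverse (real (Suc n)) < \<bar>f i x\<bar>"
            using reals_Archimedean[of "\<bar>f i x\<bar>"] by auto
          then show False
            using elim[rule_format, of n] x by (auto simp: inverse_eq_divide abs_if split: if_splits)
        qed
      qed
      with i show False by blast
    qed
  qed
  moreover have "countable (\<Union>n. ?L n)"
    by (rule countable_UN[OF countableI_type])
      (rule countable_finite, rule finite_large_on_set[OF A], simp)
  ultimately show ?thesis by (rule countable_subset)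
qed

text \<open>The support of \<open>f j\<close> is a countable union of level sets of finite measure,
  hence up to a null set it is covered by countably many atoms. Outside a countable set of indices,
  \<open>f i\<close> vanishes almost everywhere on all of these atoms.\<close>

lemma countable_overlap:
  assumes j: "j \<in> I"
  shows "countable {i\<in>I. \<not> (AE x in M. f i x = 0 \<or> f j x = 0)}"
proof -
  define S where "S n = {x\<in>space M. 1 / real (Suc n) < \<bar>f j x\<bar>}" for n
  have [measurable]: "f j \<in> borel_measurable M" using meas j .
  have S: "S n \<in> sets M" "emeasure M (S n) < \<infinity>" for n
    using emeasure_level_single[OF j, of "1 / real (Suc n)"]
    by (auto simp: S_def intro: le_less_trans simp del: of_nat_Suc)
  have "\<exists>\<A>. countable \<A> \<and> (\<forall>A\<in>\<A>. atom M A) \<and> S n - \<Union>\<A> \<in> null_sets M" for n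
    using countable_atoms_cover[OF atomic S] by metis
  then obtain \<A> where \<A>: "\<And>n. countable (\<A> n)" "\<And>n A. A \<in> \<A> n \<Longrightarrow> atom M A"
    "\<And>n. S n - \<Union>(\<A> n) \<in> null_sets M" by metis
  let ?Z = "\<lambda>i A. AE x in M. x \<in> A \<longrightarrow> f i x = 0"
  have "AE x in M. f i x = 0 \<or> f j x = 0" if Z: "\<And>n A. A \<in> \<A> n \<Longrightarrow> ?Z i A" for i
  proof -
    have "AE x in M. \<forall>n. \<forall>A\<in>\<A> n. x \<in> A \<longrightarrow> f i x = 0"
      unfolding AE_all_countable using \<A>(1) Z by (simp only: AE_ball_countable) blast
    moreover have "AE x in M. \<forall>n. x \<notin> S n - \<Union>(\<A> n)"
      unfolding AE_all_countable using \<A>(3) by (blast intro: AE_not_in)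
    ultimately show ?thesis
      using AE_space
    proof eventually_elim
      case (elim x)
      show ?case
      proof (rule ccontr)
        assume x: "\<not> (f i x = 0 \<or> f j x = 0)"
        then obtain n where "inverse (real (Suc n)) < \<bar>f j x\<bar>"
          using reals_Archimedean[of "\<bar>f j x\<bar>"] by auto
        then have "x \<in> S n" using elim by (simp add: S_def inverse_eq_divide)
        with elim x show False by blast
      qed
    qed
  qed
  then have "{i\<in>I. \<not> (AE x in M. f i x = 0 \<or> f j x = 0)} \<subseteq> (\<Union>n. \<Union>A\<in>\<A> n. {i\<in>I. \<not> ?Z i A})"
    by blast
  moreover have "countable (\<Union>n. \<Union>A\<in>\<A> n. {i\<in>I. \<not> ?Z i A})"
    using \<A> by (intro countable_UN countable_nonzero_on_atom) auto
  ultimately show ?thesis by (rule countable_subset)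
qed

section \<open>Almost disjoint finite subfamilies\<close>

definition almost_disjoint :: "'i set \<Rightarrow> bool" where
  "almost_disjoint F \<longleftrightarrow> (\<forall>i\<in>F. \<forall>j\<in>F. i \<noteq> j \<longrightarrow> (AE x in M. f i x = 0 \<or> f j x = 0))"

text \<open>Greedy choice: a finite set of indices rules out only countably many others, so an
  uncountable \<open>J\<close> always offers one more. The set \<open>J\<close> is kept general so
  that it may also consist of indices with a common level.\<close>

lemma almost_disjoint_subset_exists:
  assumes J: "uncountable J" "J \<subseteq> I"
  shows "\<exists>F\<subseteq>J. finite F \<and> card F = n \<and> almost_disjoint F"
proof (induction n)
  case 0
  show ?case by (intro exI[of _ "{}"]) (auto simp: almost_disjoint_def)
next
  case (Suc n)
  then obtain F where F: "F \<subseteq> J" "finite F" "card F = n" "almost_disjoint F" by blast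
  have "countable (F \<union> (\<Union>j\<in>F. {i\<in>I. \<not> (AE x in M. f i x = 0 \<or> f j x = 0)}))"
    using F J by (intro countable_Un countable_UN countable_finite countable_overlap) auto
  then have "\<not> J \<subseteq> F \<union> (\<Union>j\<in>F. {i\<in>I. \<not> (AE x in M. f i x = 0 \<or> f j x = 0)})"
    using J(1) countable_subset by blast
  then obtain i where i: "i \<in> J" "i \<notin> F"
    "\<And>j. j \<in> F \<Longrightarrow> AE x in M. f i x = 0 \<or> f j x = 0"
    using J(2) by blast
  then have "AE x in M. f j x = 0 \<or> f i x = 0" if "j \<in> F" for j
    using that by (auto elim!: eventually_mono dest!: i(3))
  with i F have "almost_disjoint (insert i F)" by (auto simp: almost_disjoint_def)
  with i F show ?case by (intro exI[of _ "insert i F"]) auto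
qed

text \<open>At almost every point at most one summand is nonzero, so the indicator of the level set
  of the sum is the sum of the indicators. Positivity of \<open>t\<close> keeps the zeros of a
  function out of its level set.\<close>

lemma emeasure_level_almost_disjoint:
  assumes F: "finite F" "F \<subseteq> I" "almost_disjoint F" and t: "0 < t"
  shows "emeasure M {x\<in>space M. t < \<bar>\<Sum>i\<in>F. f i x\<bar>} = (\<Sum>i\<in>F. emeasure M {x\<in>space M. t < \<bar>f i x\<bar>})"
proof -
  have [measurable]: "f i \<in> borel_measurable M" if "i \<in> F" for i using meas F that by auto
  let ?B = "\<lambda>i. {x\<in>space M. t < \<bar>f i x\<bar>}"
  have "AE x in M. \<forall>i\<in>F. \<forall>j\<in>F. i \<noteq> j \<longrightarrow> f i x = 0 \<or> f j x = 0"
  proof (rule AE_finite_allI[OF F(1)], rule AE_finite_allI[OF F(1)])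
    fix i j assume "i \<in> F" "j \<in> F"
    with F(3) show "AE x in M. i \<noteq> j \<longrightarrow> f i x = 0 \<or> f j x = 0"
      unfolding almost_disjoint_def by (cases "i = j") auto
  qed
  then have "AE x in M. (indicator {x\<in>space M. t < \<bar>\<Sum>i\<in>F. f i x\<bar>} x :: ennreal)
      = (\<Sum>i\<in>F. indicator (?B i) x)"
    using AE_space
  proof eventually_elim
    case (elim x)
    show ?case
    proof (cases "\<exists>i\<in>F. f i x \<noteq> 0")
      case True
      then obtain i where i: "i \<in> F" "f i x \<noteq> 0" by blast
      with elim have z: "f j x = 0" if "j \<in> F - {i}" for j using that by blast
      have "(\<Sum>j\<in>F. f j x) = f i x"
        using F i z by (subst sum.remove[of _ i]) auto
      moreover have "(\<Sum>j\<in>F. indicator (?B j) x) = (indicator (?B i) x :: ennreal)"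
        using F i z t by (subst sum.remove[of _ i]) (auto intro!: sum.neutral)
      ultimately show ?thesis by (simp add: indicator_def)
    next
      case False
      then show ?thesis using t by (auto simp: indicator_def intro!: sum.neutral[symmetric])
    qed
  qed
  then have "(\<integral>\<^sup>+x. indicator {x\<in>space M. t < \<bar>\<Sum>i\<in>F. f i x\<bar>} x \<partial>M)
      = (\<integral>\<^sup>+x. (\<Sum>i\<in>F. indicator (?B i) x) \<partial>M)"
    by (rule nn_integral_cong_AE)
  also have "\<dots> = (\<Sum>i\<in>F. \<integral>\<^sup>+x. indicator (?B i) x \<partial>M)"
    by (rule nn_integral_sum) simp
  finally show ?thesis by (simp cong: sum.cong)
qed

text \<open>The lower norm bound gives each \<open>f i\<close> a level with a large level set.
  Rounding that level down to a rational leaves countably many values, one of which must serve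
  uncountably many indices.\<close>

lemma uncountable_common_level:
  obtains t \<delta> J where "0 < t" "0 < \<delta>" "uncountable J" "J \<subseteq> I"
    "\<And>i. i \<in> J \<Longrightarrow> ennreal \<delta> \<le> emeasure M {x\<in>space M. t < \<bar>f i x\<bar>}"
proof -
  \<comment> \<open>One factor \<open>2\<close> in the \<open>4\<close> comes from relaxing the norm
    bound \<open>c\<close> to \<open>c / 2\<close>, the other from a rational \<open>q\<close> that
    may be nearly half the original level.\<close>
  define P where "P q i \<longleftrightarrow>
    ennreal ((c / (4 * q)) powr p) \<le> emeasure M {x\<in>space M. q < \<bar>f i x\<bar>}" for q i
  have ex: "\<exists>q\<in>\<rat>. 0 < q \<and> P q i" if i: "i \<in> I" for i
  proof -
    have [measurable]: "f i \<in> borel_measurable M" using meas i .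
    have "ennreal c \<le> weak_norm p M (f i)" using lower[of "{i}"] i by simp
    moreover have "ennreal (c / 2) < ennreal c" using c_pos by (simp add: ennreal_lessI)
    ultimately have "\<not> weak_norm p M (f i) \<le> ennreal (c / 2)" by (meson leD le_less_trans order_trans)
    then obtain t where t: "0 < t"
      "ennreal ((c / 2 / t) powr p) \<le> emeasure M {x\<in>space M. t < \<bar>f i x\<bar>}"
      using weak_norm_le_iff[OF p_pos, of "c / 2" M "f i"] c_pos by force
    obtain q where q: "q \<in> \<rat>" "t / 2 < q" "q < t" using Rats_dense_in_real[of "t / 2" t] t by auto
    have "c / (4 * q) \<le> c / 2 / t" using q t c_pos by (simp add: field_simps)
    then have "(c / (4 * q)) powr p \<le> (c / 2 / t) powr p"
      using p_pos c_pos q t by (intro powr_mono2) auto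
    then have "ennreal ((c / (4 * q)) powr p) \<le> ennreal ((c / 2 / t) powr p)"
      by (rule ennreal_leI)
    also have "\<dots> \<le> emeasure M {x\<in>space M. t < \<bar>f i x\<bar>}" by (rule t)
    also have "\<dots> \<le> emeasure M {x\<in>space M. q < \<bar>f i x\<bar>}"
      using q by (intro emeasure_mono) auto
    finally show ?thesis using q t by (intro bexI[of _ q]) (auto simp: P_def)
  qed
  have "\<exists>q\<in>\<rat>. 0 < q \<and> uncountable {i\<in>I. P q i}"
  proof (rule ccontr)
    assume "\<not> ?thesis"
    then have "countable (\<Union>q\<in>{q\<in>\<rat>. 0 < q}. {i\<in>I. P q i})"
      by (intro countable_UN) (auto intro: countable_subset[OF _ countable_rat])
    moreover have "I \<subseteq> (\<Union>q\<in>{q\<in>\<rat>. 0 < q}. {i\<in>I. P q i})" using ex by blast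
    ultimately show False using uncountable_I countable_subset by blast
  qed
  then obtain q where "0 < q" "uncountable {i\<in>I. P q i}" by blast
  then show ?thesis
    using c_pos by (intro that[of q "(c / (4 * q)) powr p" "{i\<in>I. P q i}"]) (auto simp: P_def)
qed

end

section \<open>Comparison of growth rates\<close>

lemma powr_bounded_imp_nonpos:
  fixes a K :: real
  assumes "\<And>n :: nat. 0 < n \<Longrightarrow> real n powr a \<le> K"
  shows "a \<le> 0"
proof (rule ccontr)
  assume a: "\<not> a \<le> 0"
  have K: "1 \<le> K" using assms[of 1] by simp
  obtain n :: nat where n: "K powr (1 / a) < real n" using reals_Archimedean2 by blast
  then have pos: "0 < real n" using powr_ge_zero[of K "1 / a"] by linarith
  have "K = (K powr (1 / a)) powr a" using K a by (simp add: powr_powr)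
  also have "\<dots> < real n powr a" using n a by (intro powr_less_mono2) auto
  finally show False using assms[of n] pos by simp
qed

context l2_sign_family
begin

text \<open>The measures of the level sets add up, so the tail is at most \<open>card F\<close>
  times that of a single function; the \<open>p\<close>-th root of this factor appears in the
  norm.\<close>

lemma weak_norm_almost_disjoint_le:
  assumes F: "finite F" "F \<subseteq> I" "almost_disjoint F"
  shows "weak_norm p M (\<lambda>x. \<Sum>i\<in>F. f i x) \<le> ennreal (C * card F powr (1 / p))"
proof -
  have "emeasure M {x\<in>space M. t < \<bar>\<Sum>i\<in>F. f i x\<bar>} \<le> ennreal ((C * card F powr (1/p) / t) powr p)"
    if t: "0 < t" for t
  proof -
    have "emeasure M {x\<in>space M. t < \<bar>\<Sum>i\<in>F. f i x\<bar>} = (\<Sum>i\<in>F. emeasure M {x\<in>space M. t < \<bar>f i x\<bar>})"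
      by (rule emeasure_level_almost_disjoint[OF F t])
    also have "\<dots> \<le> (\<Sum>i\<in>F. ennreal ((C / t) powr p))"
      by (rule sum_mono, rule emeasure_level_single) (use F t in auto)
    also have "\<dots> = ennreal (real (card F) * (C / t) powr p)"
      by (simp add: ennreal_mult ennreal_of_nat_eq_real_of_nat)
    also have "real (card F) * (C / t) powr p = (card F powr (1/p) * (C / t)) powr p"
      using t C_pos p_pos by (subst powr_mult) (auto simp: powr_powr)
    finally show ?thesis by (simp add: mult_ac)
  qed
  moreover have "0 \<le> C * card F powr (1 / p)" using C_pos by simp
  ultimately show ?thesis using weak_norm_le_iff[OF p_pos] by blast
qed

text \<open>For \<open>n\<close> almost disjoint functions the sum has norm at least
  \<open>c * sqrt n\<close> and at most \<open>C * n powr (1/p)\<close>, so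
  \<open>n powr (1/2 - 1/p)\<close> stays bounded.\<close>

lemma exponent_le_2: "p \<le> 2"
proof -
  have "real n powr (1/2 - 1/p) \<le> C / c" if n: "0 < n" for n :: nat
  proof -
    obtain F where F: "F \<subseteq> I" "finite F" "card F = n" "almost_disjoint F"
      using almost_disjoint_subset_exists[OF uncountable_I order_refl] by blast
    have "ennreal (c * sqrt (card F)) \<le> ennreal (C * card F powr (1 / p))"
      using lower[of F] weak_norm_almost_disjoint_le[of F] F by (meson order_trans)
    then have "c * sqrt n \<le> C * n powr (1 / p)"
      using F C_pos by (simp add: ennreal_le_iff)
    then have "c * n powr (1/2) / n powr (1/p) \<le> C"
      using n by (simp add: powr_half_sqrt divide_le_eq)
    then show ?thesis using c_pos by (simp add: powr_diff pos_le_divide_eq mult.commute)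
  qed
  then have "1/2 - 1/p \<le> 0" by (rule powr_bounded_imp_nonpos)
  then show ?thesis using p_pos by (simp add: field_simps)
qed

text \<open>With a common level \<open>t\<close>, the sum of \<open>n\<close> almost disjoint
  functions exceeds \<open>t\<close> on a set of measure at least \<open>n * \<delta>\<close>, while
  the norm bound allows only a multiple of \<open>n powr (p/2)\<close>.\<close>

lemma exponent_ge_2: "2 \<le> p"
proof -
  obtain t \<delta> J where J: "0 < t" "0 < \<delta>" "uncountable J" "J \<subseteq> I"
    "\<And>i. i \<in> J \<Longrightarrow> ennreal \<delta> \<le> emeasure M {x\<in>space M. t < \<bar>f i x\<bar>}"
    using uncountable_common_level by blast
  have "real n powr (1 - p/2) \<le> (C / t) powr p / \<delta>" if n: "0 < n" for n :: nat
  proof -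
    obtain F where F: "F \<subseteq> J" "finite F" "card F = n" "almost_disjoint F"
      using almost_disjoint_subset_exists[OF J(3,4)] by blast
    have FI: "F \<subseteq> I" using F J by blast
    have "ennreal (real n * \<delta>) = (\<Sum>i\<in>F. ennreal \<delta>)"
      using F J by (simp add: ennreal_mult ennreal_of_nat_eq_real_of_nat)
    also have "\<dots> \<le> (\<Sum>i\<in>F. emeasure M {x\<in>space M. t < \<bar>f i x\<bar>})"
      by (rule sum_mono, rule J(5)) (use F in auto)
    also have "\<dots> = emeasure M {x\<in>space M. t < \<bar>\<Sum>i\<in>F. f i x\<bar>}"
      by (rule emeasure_level_almost_disjoint[symmetric]) (use F FI J in auto)
    also have "\<dots> \<le> ennreal ((C * sqrt (card F) / t) powr p)"
      using emeasure_level_le[of F "\<lambda>_. 1" t] F FI J by simp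
    finally have "real n * \<delta> \<le> (C * sqrt n / t) powr p"
      using F by simp
    also have "C * sqrt n / t = C / t * n powr (1/2)" using n by (simp add: powr_half_sqrt)
    also have "\<dots> powr p = (C / t) powr p * n powr (p / 2)"
      using C_pos J(1) by (subst powr_mult) (auto simp: powr_powr)
    finally have "n * \<delta> / n powr (p / 2) \<le> (C / t) powr p"
      using n by (simp add: divide_le_eq)
    then show ?thesis using n J(2) by (simp add: powr_diff pos_le_divide_eq mult.commute)
  qed
  then have "1 - p/2 \<le> 0" by (rule powr_bounded_imp_nonpos)
  then show ?thesis by simp
qed

end

section \<open>Transfer along an isomorphic embedding\<close>

text \<open>The images \<open>T (e i)\<close> form an \<open>l2_sign_family\<close>. The source
  space enters only through the signed sums of \<open>e\<close>, so the same argument serves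
  \<open>ell2\<close> and the cube.\<close>

lemma iso_embeds_l2_signs_imp_exponent:
  fixes M :: "'o measure" and e :: "'i \<Rightarrow> 'a \<Rightarrow> real"
  assumes M: "atomic_on_finite M" and p: "0 < p" and I: "uncountable I"
    and emb: "iso_embeds X nX (weak_Lp p M) (weak_norm p M)"
    and a: "0 < a"
    and X: "\<And>F s. finite F \<Longrightarrow> F \<subseteq> I \<Longrightarrow> s \<in> F \<rightarrow> {-1, 1} \<Longrightarrow>
      (\<lambda>x. \<Sum>i\<in>F. s i * e i x) \<in> X \<and>
      a * sqrt (card F) \<le> nX (\<lambda>x. \<Sum>i\<in>F. s i * e i x) \<and>
      nX (\<lambda>x. \<Sum>i\<in>F. s i * e i x) \<le> b * sqrt (card F)"
  shows "p = 2"
proof -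
  obtain T c C where cC: "0 < c" "0 < C"
    and T: "\<And>g. g \<in> X \<Longrightarrow> T g \<in> weak_Lp p M \<and> ennreal (c * nX g) \<le> weak_norm p M (T g) \<and>
      weak_norm p M (T g) \<le> ennreal (C * nX g)"
    and lin: "\<And>g h \<alpha> \<beta>. g \<in> X \<Longrightarrow> h \<in> X \<Longrightarrow>
      weak_norm p M (\<lambda>y. T (\<lambda>x. \<alpha> * g x + \<beta> * h x) y - (\<alpha> * T g y + \<beta> * T h y)) = 0"
    using emb unfolding iso_embeds_def by blast
  have T_meas: "T g \<in> borel_measurable M" if "g \<in> X" for g
    using T[OF that] by (simp add: weak_Lp_def)
  \<comment> \<open>That the combination lies in \<open>X\<close> makes its image measurable, which
    is needed to pass from norm zero to vanishing almost everywhere.\<close>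
  have lin_AE: "AE y in M. T (\<lambda>x. \<alpha> * g x + \<beta> * h x) y = \<alpha> * T g y + \<beta> * T h y"
    if "g \<in> X" "h \<in> X" "(\<lambda>x. \<alpha> * g x + \<beta> * h x) \<in> X" for g h \<alpha> \<beta>
  proof -
    have [measurable]: "T g \<in> borel_measurable M" "T h \<in> borel_measurable M"
      "T (\<lambda>x. \<alpha> * g x + \<beta> * h x) \<in> borel_measurable M" using that T_meas by auto
    have "AE y in M. T (\<lambda>x. \<alpha> * g x + \<beta> * h x) y - (\<alpha> * T g y + \<beta> * T h y) = 0"
      by (rule weak_norm_eq_0_imp_AE[OF _ p lin[OF that(1,2)]]) measurable
    then show ?thesis by simp
  qed
  have e: "e i \<in> X" if "i \<in> I" for i
    using X[of "{i}" "\<lambda>_. 1"] that by simp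
  have meas: "T (e i) \<in> borel_measurable M" if "i \<in> I" for i
    using T_meas e that by blast
  have T_sum: "AE y in M. T (\<lambda>x. \<Sum>i\<in>F. s i * e i x) y = (\<Sum>i\<in>F. s i * T (e i) y)"
    if "finite F" "F \<subseteq> I" "s \<in> F \<rightarrow> {-1, 1}" for F s
    using that
  proof (induction F)
    case empty
    \<comment> \<open>Linearity with both coefficients \<open>0\<close> shows that \<open>T\<close>
      maps the zero function to zero almost everywhere.\<close>
    have "(\<lambda>_. 0) \<in> X" using X[of "{}" "\<lambda>_. 1"] by simp
    from lin_AE[OF this this, of 0 0] this show ?case by simp
  next
    case (insert j F)
    have eq: "(\<lambda>x. \<Sum>i\<in>insert j F. s i * e i x) = (\<lambda>x. 1 * (\<Sum>i\<in>F. s i * e i x) + s j * e j x)"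
      using insert by (simp add: fun_eq_iff add.commute)
    have "AE y in M. T (\<lambda>x. 1 * (\<Sum>i\<in>F. s i * e i x) + s j * e j x) y
        = 1 * T (\<lambda>x. \<Sum>i\<in>F. s i * e i x) y + s j * T (e j) y"
    proof (rule lin_AE)
      show "(\<lambda>x. \<Sum>i\<in>F. s i * e i x) \<in> X" using X[of F s] insert by auto
      show "e j \<in> X" using e insert by auto
      show "(\<lambda>x. 1 * (\<Sum>i\<in>F. s i * e i x) + s j * e j x) \<in> X"
        using X[of "insert j F" s] insert unfolding eq by auto
    qed
    moreover have "AE y in M. T (\<lambda>x. \<Sum>i\<in>F. s i * e i x) y = (\<Sum>i\<in>F. s i * T (e i) y)"
      using insert by auto
    ultimately show ?case
      unfolding eq by eventually_elim (use insert in \<open>simp add: add.commute\<close>)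
  qed
  have norm_eq: "weak_norm p M (\<lambda>y. \<Sum>i\<in>F. s i * T (e i) y) = weak_norm p M (T (\<lambda>x. \<Sum>i\<in>F. s i * e i x))"
    if F: "finite F" "F \<subseteq> I" "s \<in> F \<rightarrow> {-1, 1}" for F s
  proof (rule weak_norm_cong_AE)
    show "T (\<lambda>x. \<Sum>i\<in>F. s i * e i x) \<in> borel_measurable M" using T_meas X[OF F] by blast
    show "(\<lambda>y. \<Sum>i\<in>F. s i * T (e i) y) \<in> borel_measurable M"
      by (rule borel_measurable_sum, rule borel_measurable_times)
        (use meas F in auto)
    show "AE y in M. (\<Sum>i\<in>F. s i * T (e i) y) = T (\<lambda>x. \<Sum>i\<in>F. s i * e i x) y"
      using T_sum[OF F] by eventually_elim simp
  qed
  \<comment> \<open>A single basis element yields \<open>a \<le> b\<close>, so that the upper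
    constant \<open>C * b\<close> is positive.\<close>
  obtain i where "i \<in> I" using I by fastforce
  then have b: "a \<le> b" using X[of "{i}" "\<lambda>_. 1"] by simp
  interpret l2_sign_family M p I "\<lambda>i. T (e i)" "c * a" "C * b"
  proof
    fix F s assume F: "finite F" "F \<subseteq> I" "s \<in> F \<rightarrow> {-1, 1 :: real}"
    have "weak_norm p M (T (\<lambda>x. \<Sum>i\<in>F. s i * e i x)) \<le> ennreal (C * nX (\<lambda>x. \<Sum>i\<in>F. s i * e i x))"
      using T X[OF F] by blast
    also have "\<dots> \<le> ennreal (C * (b * sqrt (card F)))"
      using X[OF F] cC by (intro ennreal_leI mult_left_mono) auto
    finally show "weak_norm p M (\<lambda>y. \<Sum>i\<in>F. s i * T (e i) y) \<le> ennreal (C * b * sqrt (card F))"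
      by (simp add: norm_eq[OF F] mult.assoc)
  next
    fix F assume F: "finite F" "F \<subseteq> I"
    have F': "(\<lambda>_. 1) \<in> F \<rightarrow> {-1, 1 :: real}" by simp
    have "ennreal (c * (a * sqrt (card F))) \<le> ennreal (c * nX (\<lambda>x. \<Sum>i\<in>F. 1 * e i x))"
      using X[OF F F'] cC by (intro ennreal_leI mult_left_mono) auto
    also have "\<dots> \<le> weak_norm p M (T (\<lambda>x. \<Sum>i\<in>F. 1 * e i x))"
      using T X[OF F F'] by blast
    finally show "ennreal (c * a * sqrt (card F)) \<le> weak_norm p M (\<lambda>y. \<Sum>i\<in>F. T (e i) y)"
      using norm_eq[OF F F'] by (simp add: mult.assoc)
  qed (use M p I meas a b cC in auto)
  show ?thesis using exponent_le_2 exponent_ge_2 by simp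
qed

section \<open>Signed sums of unit vectors in \<open>ell2\<close>\<close>

text \<open>The sum equals \<open>s\<close> on \<open>F\<close> and \<open>0\<close> elsewhere, so
  its square is the indicator of \<open>F\<close>.\<close>

lemma ell2_sign_sum:
  assumes F: "finite F" "F \<subseteq> I" "s \<in> F \<rightarrow> {-1, 1 :: real}"
  defines "g \<equiv> \<lambda>x. \<Sum>i\<in>F. s i * (if x = i then 1 else 0)"
  shows "g \<in> ell2 I" "ell2_norm I g = sqrt (card F)"
proof -
  have g: "g x = (if x \<in> F then s x else 0)" for x
    unfolding g_def using F(1) by (simp add: if_distrib cong: if_cong)
  have sq: "(g x)\<^sup>2 = (if x \<in> F then 1 else 0)" for x
    using F(3) by (auto simp: g Pi_iff)
  have "((\<lambda>i. (g i)\<^sup>2) has_sum real (card F)) I \<longleftrightarrow> ((\<lambda>_. 1 :: real) has_sum real (card F)) F"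
    using F(2) by (intro has_sum_cong_neutral) (auto simp: sq)
  moreover have "((\<lambda>_. 1 :: real) has_sum real (card F)) F"
    using has_sum_finite[OF F(1), of "\<lambda>_. 1 :: real"] by simp
  ultimately have hs: "((\<lambda>i. (g i)\<^sup>2) has_sum real (card F)) I" by simp
  then show "ell2_norm I g = sqrt (card F)" by (simp add: ell2_norm_def infsumI)
  show "g \<in> ell2 I" using hs F(2) by (auto simp: ell2_def g summable_on_def)
qed

section \<open>Moments of signed coordinate sums on the cube\<close>

lemma prob_space_cantor_cube: "prob_space (cantor_cube I)"
  unfolding cantor_cube_def by (intro prob_space_PiM prob_space_uniform_count_measure) auto

lemma measurable_cantor_cube_coordinate:
  assumes "i \<in> I"
  shows "(\<lambda>x. x i) \<in> borel_measurable (cantor_cube I)"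
proof -
  have "(\<lambda>x. x i) \<in> cantor_cube I \<rightarrow>\<^sub>M uniform_count_measure {-1, 1::real}"
    unfolding cantor_cube_def using assms by measurable
  moreover have "(\<lambda>y::real. y) \<in> borel_measurable (uniform_count_measure {-1, 1::real})"
    by (subst measurable_cong_sets[OF sets_uniform_count_measure_count_space refl]) simp
  ultimately show ?thesis by (rule measurable_compose)
qed

lemma cantor_cube_coordinate:
  assumes "x \<in> space (cantor_cube I)" "i \<in> I"
  shows "x i \<in> {-1, 1}"
  using assms by (auto simp: cantor_cube_def space_PiM space_uniform_count_measure PiE_iff)

text \<open>The integrand depends on finitely many coordinates, so the integral may be taken over
  the finite product, where it factors; each factor is the mean of the values at \<open>-1\<close>
  and \<open>1\<close>.\<close>

lemma integral_cantor_cube_prod: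
  fixes g :: "'i \<Rightarrow> real \<Rightarrow> real"
  assumes F: "finite F" "F \<subseteq> I"
  shows "(\<integral>x. (\<Prod>i\<in>F. g i (x i)) \<partial>cantor_cube I) = (\<Prod>i\<in>F. (g i (-1) + g i 1) / 2)"
proof -
  let ?U = "uniform_count_measure {-1, 1::real}"
  have "prob_space ?U" by (rule prob_space_uniform_count_measure) auto
  then interpret cube: product_prob_space "\<lambda>_. ?U" I
    by (intro product_prob_spaceI)
  have mU: "h \<in> borel_measurable ?U" for h :: "real \<Rightarrow> real"
    by (subst measurable_cong_sets[OF sets_uniform_count_measure_count_space refl]) simp
  have "(\<integral>x. (\<Prod>i\<in>F. g i (x i)) \<partial>PiM F (\<lambda>_. ?U))
      = (\<integral>x. (\<Prod>i\<in>F. g i (x i)) \<partial>distr (PiM I (\<lambda>_. ?U)) (PiM F (\<lambda>_. ?U)) (\<lambda>x. restrict x F))"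
    using cube.distr_PiM_restrict_finite[OF F] by simp
  also have "\<dots> = (\<integral>x. (\<Prod>i\<in>F. g i (restrict x F i)) \<partial>cantor_cube I)"
    unfolding cantor_cube_def
  proof (rule integral_distr)
    show "(\<lambda>x. restrict x F) \<in> PiM I (\<lambda>_. ?U) \<rightarrow>\<^sub>M PiM F (\<lambda>_. ?U)"
      by (rule measurable_restrict_subset[OF F(2)])
    show "(\<lambda>x. \<Prod>i\<in>F. g i (x i)) \<in> borel_measurable (PiM F (\<lambda>_. ?U))"
    proof (rule borel_measurable_prod)
      fix i assume i: "i \<in> F"
      show "(\<lambda>x. g i (x i)) \<in> borel_measurable (PiM F (\<lambda>_. ?U))"
        by (rule measurable_compose[where g = "g i", OF measurable_component_singleton[OF i] mU])
    qed
  qed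
  also have "\<dots> = (\<integral>x. (\<Prod>i\<in>F. g i (x i)) \<partial>cantor_cube I)"
    by (simp cong: prod.cong)
  finally have "(\<integral>x. (\<Prod>i\<in>F. g i (x i)) \<partial>cantor_cube I)
      = (\<integral>x. (\<Prod>i\<in>F. g i (x i)) \<partial>PiM F (\<lambda>_. ?U))" by simp
  also have "\<dots> = (\<Prod>i\<in>F. integral\<^sup>L ?U (g i))"
  proof (rule cube.product_integral_prod[OF F(1)])
    show "integrable ?U (g i)" for i
      unfolding uniform_count_measure_def by (rule integrable_point_measure_finite) auto
  qed
  finally show ?thesis by (simp add: integral_uniform_count_measure)
qed

context
  fixes I F :: "'i set" and s :: "'i \<Rightarrow> real"
  assumes F: "finite F" "F \<subseteq> I" and s: "s \<in> F \<rightarrow> {-1, 1}"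
begin

interpretation prob_space "cantor_cube I" by (rule prob_space_cantor_cube)

lemma rademacher_sum_measurable:
  "(\<lambda>x. \<Sum>i\<in>F. s i * x i) \<in> borel_measurable (cantor_cube I)"
  by (intro borel_measurable_sum borel_measurable_times borel_measurable_const
      measurable_cantor_cube_coordinate) (use F in auto)

lemma rademacher_sum_abs_le:
  assumes "x \<in> space (cantor_cube I)"
  shows "\<bar>\<Sum>i\<in>F. s i * x i\<bar> \<le> card F"
proof -
  have "\<bar>s i * x i\<bar> \<le> 1" if "i \<in> F" for i
    using cantor_cube_coordinate[OF assms, of i] s subsetD[OF F(2) that] that
    by (auto simp: Pi_iff)
  then have "(\<Sum>i\<in>F. \<bar>s i * x i\<bar>) \<le> real (card F)"
    using sum_bounded_above[of F "\<lambda>i. \<bar>s i * x i\<bar>" 1] by simp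
  then show ?thesis using sum_abs[of "\<lambda>i. s i * x i" F] by linarith
qed

lemma integrable_exp_rademacher_sum:
  "integrable (cantor_cube I) (\<lambda>x. exp (l * (\<Sum>i\<in>F. s i * x i)))"
proof (rule integrable_const_bound[where B = "exp (\<bar>l\<bar> * card F)"])
  have "l * (\<Sum>i\<in>F. s i * x i) \<le> \<bar>l\<bar> * card F" if "x \<in> space (cantor_cube I)" for x
  proof -
    have "l * (\<Sum>i\<in>F. s i * x i) \<le> \<bar>l\<bar> * \<bar>\<Sum>i\<in>F. s i * x i\<bar>"
      by (metis abs_ge_self abs_mult)
    also have "\<dots> \<le> \<bar>l\<bar> * card F"
      by (rule mult_left_mono[OF rademacher_sum_abs_le[OF that]]) simp
    finally show ?thesis .
  qed
  then show "AE x in cantor_cube I. norm (exp (l * (\<Sum>i\<in>F. s i * x i))) \<le> exp (\<bar>l\<bar> * card F)"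
    by (intro AE_I2) simp
  show "(\<lambda>x. exp (l * (\<Sum>i\<in>F. s i * x i))) \<in> borel_measurable (cantor_cube I)"
    by (rule measurable_compose[OF
        borel_measurable_times[OF borel_measurable_const rademacher_sum_measurable] borel_measurable_exp])
qed

text \<open>The exponential of the sum is a product over coordinates, and each sign disappears
  because \<open>cosh\<close> is even.\<close>

lemma expectation_exp_rademacher_sum:
  "expectation (\<lambda>x. exp (l * (\<Sum>i\<in>F. s i * x i))) = cosh l ^ card F"
proof -
  have "expectation (\<lambda>x. exp (l * (\<Sum>i\<in>F. s i * x i)))
      = expectation (\<lambda>x. \<Prod>i\<in>F. exp (l * s i * x i))"
    using F by (simp add: sum_distrib_left exp_sum mult.assoc)
  also have "\<dots> = (\<Prod>i\<in>F. (exp (l * s i * -1) + exp (l * s i * 1)) / 2)"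
    by (rule integral_cantor_cube_prod[OF F])
  also have "\<dots> = (\<Prod>i\<in>F. cosh l)"
    using s by (intro prod.cong) (auto simp: cosh_def Pi_iff)
  finally show ?thesis by simp
qed

text \<open>The coordinates are orthonormal, and the squared signs on the diagonal are
  \<open>1\<close>.\<close>

lemma expectation_rademacher_sum_square:
  "integrable (cantor_cube I) (\<lambda>x. (\<Sum>i\<in>F. s i * x i)\<^sup>2)"
  "expectation (\<lambda>x. (\<Sum>i\<in>F. s i * x i)\<^sup>2) = card F"
proof -
  have int: "integrable (cantor_cube I) (\<lambda>x. x i * x j)" if "i \<in> F" "j \<in> F" for i j
  proof (rule integrable_const_bound[where B = 1])
    show "AE x in cantor_cube I. norm (x i * x j) \<le> 1"
    proof (rule AE_I2)
      fix x assume x: "x \<in> space (cantor_cube I)"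
      have "x i \<in> {-1, 1}" "x j \<in> {-1, 1}"
        using cantor_cube_coordinate[OF x] F that by blast+
      then show "norm (x i * x j) \<le> 1" by auto
    qed
    show "(\<lambda>x. x i * x j) \<in> borel_measurable (cantor_cube I)"
      by (intro borel_measurable_times measurable_cantor_cube_coordinate) (use F that in auto)
  qed
  have E: "expectation (\<lambda>x. x i * x j) = (if i = j then 1 else 0)" if "i \<in> F" "j \<in> F" for i j
  proof (cases "i = j")
    case True
    then show ?thesis
      using integral_cantor_cube_prod[of "{i}" I "\<lambda>_ y. y * y"] F that by auto
  next
    case False
    then show ?thesis
      using integral_cantor_cube_prod[of "{i, j}" I "\<lambda>_ y. y"] F that by auto
  qed
  have sq: "(\<Sum>i\<in>F. s i * x i)\<^sup>2 = (\<Sum>i\<in>F. \<Sum>j\<in>F. s i * s j * (x i * x j))" for x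
    by (simp add: power2_eq_square sum_product mult_ac)
  show "integrable (cantor_cube I) (\<lambda>x. (\<Sum>i\<in>F. s i * x i)\<^sup>2)"
    unfolding sq by (intro Bochner_Integration.integrable_sum integrable_mult_right int)
  have "expectation (\<lambda>x. (\<Sum>i\<in>F. s i * x i)\<^sup>2)
      = (\<Sum>i\<in>F. \<Sum>j\<in>F. s i * s j * expectation (\<lambda>x. x i * x j))"
    unfolding sq by (simp add: Bochner_Integration.integral_sum int)
  also have "\<dots> = (\<Sum>i\<in>F. \<Sum>j\<in>F. if i = j then 1 else 0)"
    using s by (intro sum.cong refl) (auto simp: E Pi_iff)
  also have "\<dots> = real (card F)" using F by simp
  finally show "expectation (\<lambda>x. (\<Sum>i\<in>F. s i * x i)\<^sup>2) = card F" .
qed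

end

section \<open>Weak norm of signed coordinate sums\<close>

lemma cosh_le_one_plus_square:
  fixes x :: real
  assumes "\<bar>x\<bar> \<le> 1"
  shows "cosh x \<le> 1 + x\<^sup>2"
proof -
  have main: "cosh y \<le> 1 + y\<^sup>2" if y: "0 \<le> y" "y \<le> 1" for y :: real
  proof -
    have "exp (-y) * (1 + y) \<le> exp (-y) * exp y" by (intro mult_left_mono exp_ge_add_one_self) auto
    also have "\<dots> = 1" by (simp add: exp_minus)
    \<comment> \<open>The product on the right equals \<open>1 + y^3\<close>. Cancelling
      \<open>1 + y\<close> gives the bound on \<open>exp (-y)\<close> that matches
      \<open>exp y \<le> 1 + y + y^2\<close>.\<close>
    also have "1 \<le> (1 - y + y\<^sup>2) * (1 + y)"
      using y by (simp add: algebra_simps power2_eq_square)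
    finally have "exp (-y) \<le> 1 - y + y\<^sup>2" using y by simp
    with exp_bound[OF y] show ?thesis by (simp add: cosh_def)
  qed
  show ?thesis using main[of "\<bar>x\<bar>"] assms by (simp add: cosh_real_abs)
qed

text \<open>The inequality \<open>u / p \<le> exp (u / p)\<close>, raised to the power
  \<open>p\<close>.\<close>

lemma powr_le_exp:
  fixes u p :: real
  assumes "0 \<le> u" "0 < p"
  shows "u powr p \<le> p powr p * exp u"
proof -
  have "u / p \<le> exp (u / p)" using exp_ge_add_one_self[of "u / p"] by linarith
  then have "(u / p) powr p \<le> exp (u / p) powr p" using assms by (intro powr_mono2) auto
  then show ?thesis using assms by (simp add: powr_divide exp_powr_real field_simps)
qed

text \<open>With \<open>W = exp (X / r) + exp (- X / r)\<close>, of expectation at most \<open>6\<close>, the upper bound is Markov's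
  inequality. For the lower bound, \<open>v = (X / r)\<^sup>2\<close> has expectation \<open>1\<close> and \<open>v\<^sup>2 \<le> 256 W\<close>; since
  \<open>v \<le> v\<^sup>2 / 6144 + 1536\<close>, bounding \<open>v\<close> by \<open>1/4\<close> where \<open>\<bar>X\<bar> \<le> r / 2\<close> shows that
  \<open>\<bar>X\<bar> > r / 2\<close> has probability at least \<open>1/3072\<close>.\<close>
lemma weak_norm_rademacher_sum:
  fixes p :: real
  assumes F: "finite F" "F \<subseteq> I" and s: "s \<in> F \<rightarrow> {-1, 1 :: real}" and p: "1 \<le> p"
  shows "ennreal (sqrt (card F) / 6144) \<le> weak_norm p (cantor_cube I) (\<lambda>x. \<Sum>i\<in>F. s i * x i)"
    "weak_norm p (cantor_cube I) (\<lambda>x. \<Sum>i\<in>F. s i * x i) \<le> ennreal (6 * p * sqrt (card F))"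
proof -
  interpret prob_space "cantor_cube I" by (rule prob_space_cantor_cube)
  define X where "X x = (\<Sum>i\<in>F. s i * x i)" for x :: "'a \<Rightarrow> real"
  define r where "r = sqrt (card F)"
  have [measurable]: "X \<in> borel_measurable (cantor_cube I)"
    unfolding X_def[abs_def] by (rule rademacher_sum_measurable[OF F s])
  have "ennreal (r / 6144) \<le> weak_norm p (cantor_cube I) X \<and>
      weak_norm p (cantor_cube I) X \<le> ennreal (6 * p * r)"
  proof (cases "F = {}")
    \<comment> \<open>Here \<open>r = 0\<close> and the sum is the zero function. Otherwise
      \<open>r \<ge> 1\<close>, which allows division by \<open>r\<close> and the quadratic bound
      for \<open>cosh (1 / r)\<close>.\<close>
    case True
    have "weak_norm p (cantor_cube I) X \<le> ennreal 0"
      using p by (subst weak_norm_le_iff) (auto simp: X_def True)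
    then show ?thesis by (simp add: r_def True)
  next
    case False
    then have n: "1 \<le> card F" using F by (simp add: Suc_le_eq card_gt_0_iff)
    then have r: "1 \<le> r" "r\<^sup>2 = card F" by (auto simp: r_def)
    define W where "W x = exp (1 / r * X x) + exp (- (1 / r) * X x)" for x
    have int_W: "integrable (cantor_cube I) W"
      unfolding W_def X_def
      by (intro Bochner_Integration.integrable_add integrable_exp_rademacher_sum[OF F s])
    have "expectation W = 2 * cosh (1 / r) ^ card F"
      unfolding W_def X_def
      by (subst Bochner_Integration.integral_add)
        (simp_all only: integrable_exp_rademacher_sum[OF F s] expectation_exp_rademacher_sum[OF F s]
          cosh_minus mult_2)
    \<comment> \<open>Since \<open>r\<close> squared is \<open>card F\<close>, each factor is at
      most \<open>exp (1 / card F)\<close> and the power is at most \<open>exp 1\<close>, whatever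
      the size of \<open>F\<close>.\<close>
    also have "cosh (1 / r) ^ card F \<le> exp (1 / card F) ^ card F"
    proof (rule power_mono)
      have "cosh (1 / r) \<le> 1 + (1 / r)\<^sup>2" using r by (intro cosh_le_one_plus_square) simp
      also have "\<dots> \<le> exp ((1 / r)\<^sup>2)" by (rule exp_ge_add_one_self)
      finally show "cosh (1 / r) \<le> exp (1 / card F)" by (simp add: power_divide r)
    qed (simp add: cosh_real_nonneg)
    also have "\<dots> = exp (1 :: real)" using n by (simp flip: exp_of_nat_mult)
    also have "\<dots> \<le> 3" by (rule exp_le)
    finally have E_W: "expectation W \<le> 6" by simp
    have int_indicator: "integrable (cantor_cube I) (\<lambda>x. indicator S x :: real)"
      if "S \<in> events" for S
      using that by (rule integrable_real_indicator) (simp add: emeasure_eq_measure)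
    \<comment> \<open>The exponential of \<open>\<bar>X x\<bar> / r\<close> is one of the two
      summands of \<open>W x\<close>, and the other is positive.\<close>
    have powr_le_W: "(\<bar>X x\<bar> / r) powr q \<le> q powr q * W x" if "0 < q" for q x
    proof -
      have "(\<bar>X x\<bar> / r) powr q \<le> q powr q * exp (\<bar>X x\<bar> / r)"
        using r that by (intro powr_le_exp) auto
      also have "exp (\<bar>X x\<bar> / r) \<le> W x" by (simp add: W_def abs_if)
      finally show ?thesis by (simp add: mult_left_mono)
    qed

    have "weak_norm p (cantor_cube I) X \<le> ennreal (6 * p * r)"
    proof (subst weak_norm_le_iff, goal_cases)
      case 3
      show ?case
      proof (intro allI impI)
        fix t :: real assume t: "0 < t"
        define S where "S = {x\<in>space (cantor_cube I). t < \<bar>X x\<bar>}"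
        have S [measurable]: "S \<in> events" by (simp add: S_def)
        have "expectation (\<lambda>x. (t / r) powr p * indicator S x) \<le> expectation (\<lambda>x. p powr p * W x)"
        proof (rule integral_mono)
          show "integrable (cantor_cube I) (\<lambda>x. (t / r) powr p * indicator S x)"
            by (rule integrable_mult_right, rule int_indicator[OF S])
          show "integrable (cantor_cube I) (\<lambda>x. p powr p * W x)"
            by (rule integrable_mult_right, rule int_W)
          fix x
          show "(t / r) powr p * indicator S x \<le> p powr p * W x"
          proof (cases "x \<in> S")
            case True
            then have "(t / r) powr p \<le> (\<bar>X x\<bar> / r) powr p"
              using t r p by (intro powr_mono2) (auto simp: S_def divide_right_mono)
            also have "\<dots> \<le> p powr p * W x" using p by (intro powr_le_W) auto
            finally show ?thesis using True by simp
          qed (simp add: W_def)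
        qed
        then have "(t / r) powr p * prob S \<le> p powr p * expectation W" by simp
        also have "\<dots> \<le> p powr p * 6" using E_W by (intro mult_left_mono) auto
        \<comment> \<open>As \<open>p \<ge> 1\<close>, the factor \<open>6\<close> can be absorbed
          into the \<open>p\<close>-th power, which produces the constant
          \<open>6 * p\<close>.\<close>
        also have "\<dots> \<le> p powr p * 6 powr p"
          using p powr_mono[of 1 p 6] by (intro mult_left_mono) auto
        also have "\<dots> = (6 * p * r / t) powr p * (t / r) powr p"
          using p r t by (simp add: mult.commute flip: powr_mult)
        finally have "prob S \<le> (6 * p * r / t) powr p" using t r by simp
        then show "emeasure (cantor_cube I) {x\<in>space (cantor_cube I). t < \<bar>X x\<bar>}
            \<le> ennreal ((6 * p * r / t) powr p)"
          by (simp add: emeasure_eq_measure S_def ennreal_leI)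
      qed
    qed (use p r in auto)
    moreover have "ennreal (r / 6144) \<le> weak_norm p (cantor_cube I) X"
    proof -
      define S where "S = {x\<in>space (cantor_cube I). r / 2 < \<bar>X x\<bar>}"
      have S [measurable]: "S \<in> events" by (simp add: S_def)
      have "expectation (\<lambda>x. (X x)\<^sup>2 / r\<^sup>2) \<le> expectation (\<lambda>x. 1/4 + W x / 24 + 1536 * indicator S x)"
      proof (rule integral_mono)
        show "integrable (cantor_cube I) (\<lambda>x. (X x)\<^sup>2 / r\<^sup>2)"
          unfolding X_def
          by (rule integrable_divide_zero) (rule expectation_rademacher_sum_square(1)[OF F s])
        show "integrable (cantor_cube I) (\<lambda>x. 1/4 + W x / 24 + 1536 * indicator S x)"
          by (rule Bochner_Integration.integrable_add, rule Bochner_Integration.integrable_add,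
              rule integrable_const, rule integrable_divide_zero, rule int_W,
              rule integrable_mult_right, rule int_indicator[OF S])
        fix x assume x: "x \<in> space (cantor_cube I)"
        define v where "v = (X x / r)\<^sup>2"
        have "(\<bar>X x\<bar> / r) powr 4 = v\<^sup>2"
          using r(1) by (simp add: v_def powr_numeral power_divide flip: power_mult)
        \<comment> \<open>The constant is \<open>4 powr 4\<close>.\<close>
        then have v2: "v\<^sup>2 \<le> 256 * W x" using powr_le_W[of 4 x] by simp
        have "v \<le> 1/4 + W x / 24 + 1536 * indicator S x"
        proof (cases "x \<in> S")
          case True
          \<comment> \<open>After division by \<open>6144\<close>, the term \<open>v^2\<close>
            contributes \<open>256 / 6144 = 1 / 24\<close> times \<open>W x\<close> and the constant
            becomes \<open>1536\<close>.\<close>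
          have "0 \<le> (v - 3072)\<^sup>2" by simp
          then have "6144 * v \<le> v\<^sup>2 + 9437184" by (simp add: power2_diff)
          with v2 True show ?thesis by simp
        next
          case False
          then have "\<bar>X x / r\<bar> \<le> 1/2" using x r by (simp add: S_def field_simps)
          then have "v \<le> (1/2)\<^sup>2"
            unfolding v_def using abs_le_square_iff[of "X x / r" "1/2"] by simp
          moreover have "0 \<le> W x" by (simp add: W_def)
          ultimately show ?thesis using False by (simp add: power2_eq_square)
        qed
        then show "(X x)\<^sup>2 / r\<^sup>2 \<le> 1/4 + W x / 24 + 1536 * indicator S x"
          by (simp add: v_def power_divide)
      qed
      also have "\<dots> = 1/4 + expectation W / 24 + 1536 * prob S"
        using int_W int_indicator[OF S] S by (simp add: prob_space)
      also have "expectation (\<lambda>x. (X x)\<^sup>2 / r\<^sup>2) = 1"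
        using expectation_rademacher_sum_square(2)[OF F s] n by (simp add: X_def r)
      \<comment> \<open>From \<open>1 \<le> 1/4 + 6/24 + 1536 * prob S\<close>.\<close>
      finally have P: "1 / 3072 \<le> prob S" using E_W by simp
      \<comment> \<open>Probabilities are at most \<open>1\<close>, so the smaller exponent
        \<open>1 / p\<close> only increases the value; this keeps the lower constant independent of
        \<open>p\<close>.\<close>
      then have "prob S powr 1 \<le> prob S powr (1 / p)"
        using p by (intro powr_mono') auto
      with P have "r / 2 * (1 / 3072) \<le> r / 2 * prob S powr (1 / p)"
        using r by (intro mult_left_mono) auto
      then have "ennreal (r / 6144) \<le> ennreal (r / 2 * prob S powr (1 / p))"
        by (intro ennreal_leI) simp
      also have "\<dots> \<le> weak_norm p (cantor_cube I) X"
        unfolding weak_norm_def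
        by (rule SUP_upper2[where i = "r / 2"]) (use r in \<open>auto simp: S_def\<close>)
      finally show ?thesis .
    qed
    ultimately show ?thesis by simp
  qed
  then show "ennreal (sqrt (card F) / 6144) \<le> weak_norm p (cantor_cube I) (\<lambda>x. \<Sum>i\<in>F. s i * x i)"
    "weak_norm p (cantor_cube I) (\<lambda>x. \<Sum>i\<in>F. s i * x i) \<le> ennreal (6 * p * sqrt (card F))"
    by (simp_all add: X_def[abs_def] r_def)
qed

theorem theorem7:
  fixes I :: "'i set" and \<Gamma> :: "'g set" and w :: "'g \<Rightarrow> real" and p :: real
  assumes "uncountable I"
    and "\<forall>g\<in>\<Gamma>. 0 < w g"
    and "1 < p" and "p \<noteq> 2"
  shows "\<not> iso_embeds (ell2 I) (ell2_norm I)
             (weak_Lp p (weighted_measure \<Gamma> w)) (weak_norm p (weighted_measure \<Gamma> w)) \<and>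
         (\<forall>M :: 'o measure.
           purely_atomic M \<longrightarrow> (\<exists>A\<in>sets M. 0 < emeasure M A \<and> emeasure M A < \<infinity>) \<longrightarrow>
           \<not> iso_embeds (weak_Lp p (cantor_cube I)) (\<lambda>f. enn2real (weak_norm p (cantor_cube I) f))
               (weak_Lp p M) (weak_norm p M))"
proof (intro conjI allI impI notI)
  assume emb: "iso_embeds (ell2 I) (ell2_norm I)
    (weak_Lp p (weighted_measure \<Gamma> w)) (weak_norm p (weighted_measure \<Gamma> w))"
  have "p = 2"
  \<comment> \<open>For unit vectors the norm of a signed sum is exactly
    \<open>sqrt (card F)\<close>, so both constants are \<open>1\<close>.\<close>
  proof (rule iso_embeds_l2_signs_imp_exponent[OF atomic_on_finite_weighted_measure[OF assms(2)]
        _ assms(1) emb, where a = 1 and b = 1 and e = "\<lambda>i x. if x = i then 1 else 0"])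
    fix F :: "'i set" and s
    assume F: "finite F" "F \<subseteq> I" "s \<in> F \<rightarrow> {-1, 1 :: real}"
    let ?g = "\<lambda>x. \<Sum>i\<in>F. s i * (if x = i then 1 else 0)"
    show "?g \<in> ell2 I \<and> 1 * sqrt (card F) \<le> ell2_norm I ?g \<and> ell2_norm I ?g \<le> 1 * sqrt (card F)"
      using ell2_sign_sum(1)[OF F] unfolding ell2_sign_sum(2)[OF F] by simp
  qed (use assms(3) in auto)
  with assms(4) show False ..
next
  fix M :: "'o measure"
  assume M: "purely_atomic M"
    and emb: "iso_embeds (weak_Lp p (cantor_cube I)) (\<lambda>f. enn2real (weak_norm p (cantor_cube I) f))
      (weak_Lp p M) (weak_norm p M)"
  have "p = 2"
  \<comment> \<open>The coordinate functions take the place of the unit vectors, with the constants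
    of \<open>weak_norm_rademacher_sum\<close>.\<close>
  proof (rule iso_embeds_l2_signs_imp_exponent[OF atomic_on_finite_purely_atomic[OF M] _ assms(1) emb,
        where a = "1 / 6144" and b = "6 * p" and e = "\<lambda>i x. x i"])
    fix F :: "'i set" and s
    assume F: "finite F" "F \<subseteq> I" "s \<in> F \<rightarrow> {-1, 1 :: real}"
    have p: "1 \<le> p" using assms(3) by simp
    define N where "N = weak_norm p (cantor_cube I) (\<lambda>x. \<Sum>i\<in>F. s i * x i)"
    have le: "ennreal (sqrt (card F) / 6144) \<le> N" "N \<le> ennreal (6 * p * sqrt (card F))"
      unfolding N_def by (rule weak_norm_rademacher_sum[OF F p])+
    \<comment> \<open>\<open>enn2real\<close> sends infinity to \<open>0\<close>, so the lower bound
      carries over to the reals only once the norm is known to be finite.\<close>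
    then have fin: "N < \<infinity>" using le_less_trans by fastforce
    have "sqrt (card F) / 6144 \<le> enn2real N"
      using enn2real_mono[OF le(1)] fin by simp
    moreover have "enn2real N \<le> 6 * p * sqrt (card F)"
      using enn2real_mono[OF le(2)] p by simp
    moreover have "(\<lambda>x. \<Sum>i\<in>F. s i * x i) \<in> weak_Lp p (cantor_cube I)"
      using fin rademacher_sum_measurable[OF F] by (simp add: weak_Lp_def N_def)
    ultimately show "(\<lambda>x. \<Sum>i\<in>F. s i * x i) \<in> weak_Lp p (cantor_cube I) \<and>
        1 / 6144 * sqrt (card F) \<le> enn2real (weak_norm p (cantor_cube I) (\<lambda>x. \<Sum>i\<in>F. s i * x i)) \<and>
        enn2real (weak_norm p (cantor_cube I) (\<lambda>x. \<Sum>i\<in>F. s i * x i)) \<le> 6 * p * sqrt (card F)"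
      by (simp add: N_def)
  qed (use assms(3) in auto)
  with assms(4) show False ..
qed

end
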